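(* Let $\mathcal{C},\mathcal{D}$ be categories and $F\colon\mathcal{C}\to\mathcal{D}^{op}$ left adjoint to $G\colon\mathcal{D}^{op}\to\mathcal{C}$. Let $A$ be an endofunctor on $\mathcal{C}$ with initial algebra $\beta\colon A(\Psi)\xrightarrow{\cong}\Psi$, $(T,\eta,\mu)$ a monad on $\mathcal{C}$, $\lambda\colon AT\Rightarrow TA$ a Kleisli law such that $(\Psi,J(\beta^{-1}))$ is a final coalgebra of the extension $\overline{A}$ of $A$ to $\mathcal{K}\ell(T)$, $L$ an endofunctor on $\mathcal{D}$ with initial algebra $\alpha\colon L(\Phi)\xrightarrow{\cong}\Phi$, $\delta\colon AG\Rightarrow GL$ a natural transformation and $\tau\colon TG\Rightarrow G$ a monad action. Assume $\delta\circ A\tau=\tau L\circ T\delta\circ\lambda G$. Let $\mathsf{k}\colon\Psi\to G(\Phi)$ be the unique map with $\mathsf{k}\circ\beta=G(\alpha^{-1})\circ\delta_\Phi\circ A(\mathsf{k})$, and $\overline{\mathsf{k}}=\tau_\Phi\circ T(\mathsf{k})\colon T(\Psi)\to G(\Phi)$. Let $\ell_{\mathrm{kl}}=T(\beta)\circ\mu_{A(\Psi)}\circ T(\lambda_\Psi)\colon TAT(\Psi)\to T(\Psi)$ and $\ell_{\mathrm{log}}=G(\alpha^{-1})\circ\tau_{L(\Phi)}\circ T(\delta_\Phi)\colon TAG(\Phi)\to G(\Phi)$. Then $\overline{\mathsf{k}}\circ\ell_{\mathrm{kl}}=\ell_{\mathrm{log}}\circ TA(\overline{\mathsf{k}})$.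 Consequently, for every coalgebra $c\colon X\to TA(X)$, $\overline{\mathsf{k}}\circ\mathsf{kl}_c=\mathsf{log}_c$, where $\mathsf{kl}_c\colon X\to T(\Psi)$ is the unique map with $\mathsf{kl}_c=\ell_{\mathrm{kl}}\circ TA(\mathsf{kl}_c)\circ c$ and $\mathsf{log}_c\colon X\to G(\Phi)$ is the unique map with $\mathsf{log}_c=\ell_{\mathrm{log}}\circ TA(\mathsf{log}_c)\circ c$.
   Context: $L$ is also regarded as an endofunctor of $\mathcal{D}^{op}$; $G(\alpha^{-1})\colon GL(\Phi)\to G(\Phi)$ is $G$ applied to $\alpha^{-1}$ viewed as a morphism $L(\Phi)\to\Phi$ in $\mathcal{D}^{op}$. A Kleisli law satisfies $\lambda\circ A\eta=\eta A$ and $\lambda\circ A\mu=\mu A\circ T\lambda\circ\lambda T$; its extension $\overline{A}$ to the Kleisli category sends a Kleisli map $f\colon X\to T(Y)$ to $\lambda_Y\circ A(f)$, and $J\colon\mathcal{C}\to\mathcal{K}\ell(T)$ is the identity on objects with $J(f)=\eta\circ f$. A monad action satisfies $\tau\circ\eta G=\mathrm{id}$ and $\tau\circ\mu G=\tau\circ T\tau$. The maps $\mathsf{k}$, $\mathsf{kl}_c$, $\mathsf{log}_c$ described exist and are unique. *)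

theory Defs
  imports Main
begin

section \<open>Categories\<close>

record ('o, 'm) cat =
  Obj :: "'o set"
  Arr :: "'m set"
  Dom :: "'m \<Rightarrow> 'o"
  Cod :: "'m \<Rightarrow> 'o"
  Id :: "'o \<Rightarrow> 'm"
  Comp :: "'m \<Rightarrow> 'm \<Rightarrow> 'm"  (infixr \<open>\<cdot>\<index>\<close> 65)

definition Hom :: "('o, 'm) cat \<Rightarrow> 'o \<Rightarrow> 'o \<Rightarrow> 'm set" where
  "Hom C X Y = {f \<in> Arr C. Dom C f = X \<and> Cod C f = Y}"

locale category =
  fixes C :: "('o, 'm) cat" (structure)
  assumes dom_obj: "f \<in> Arr C \<Longrightarrow> Dom C f \<in> Obj C"
    and cod_obj: "f \<in> Arr C \<Longrightarrow> Cod C f \<in> Obj C"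
    and id_hom: "X \<in> Obj C \<Longrightarrow> Id C X \<in> Hom C X X"
    and comp_hom: "\<lbrakk>f \<in> Hom C X Y; g \<in> Hom C Y Z\<rbrakk> \<Longrightarrow> g \<cdot> f \<in> Hom C X Z"
    and id_left: "f \<in> Hom C X Y \<Longrightarrow> Id C Y \<cdot> f = f"
    and id_right: "f \<in> Hom C X Y \<Longrightarrow> f \<cdot> Id C X = f"
    and assoc: "\<lbrakk>f \<in> Hom C W X; g \<in> Hom C X Y; h \<in> Hom C Y Z\<rbrakk>
                  \<Longrightarrow> (h \<cdot> g) \<cdot> f = h \<cdot> (g \<cdot> f)"

definition op_cat :: "('o, 'm) cat \<Rightarrow> ('o, 'm) cat" where
  "op_cat C = \<lparr>Obj = Obj C, Arr = Arr C, Dom = Cod C, Cod = Dom C, Id = Id C,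
                Comp = (\<lambda>g f. f \<cdot>\<^bsub>C\<^esub> g)\<rparr>"

definition inverse_arrows :: "('o, 'm) cat \<Rightarrow> 'm \<Rightarrow> 'm \<Rightarrow> bool" where
  "inverse_arrows C f g \<longleftrightarrow> f \<in> Arr C \<and> g \<in> Hom C (Cod C f) (Dom C f) \<and>
     g \<cdot>\<^bsub>C\<^esub> f = Id C (Dom C f) \<and> f \<cdot>\<^bsub>C\<^esub> g = Id C (Cod C f)"

definition inv_arr :: "('o, 'm) cat \<Rightarrow> 'm \<Rightarrow> 'm" where
  "inv_arr C f = (THE g. inverse_arrows C f g)"


section \<open>Functors, natural transformations, adjunctions\<close>

record ('o1, 'm1, 'o2, 'm2) fctr =
  ob :: "'o1 \<Rightarrow> 'o2"
  ar :: "'m1 \<Rightarrow> 'm2"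

locale is_functor = C: category C + D: category D
  for C :: "('o1, 'm1) cat" and D :: "('o2, 'm2) cat" and F :: "('o1, 'm1, 'o2, 'm2) fctr" +
  assumes ob_obj: "X \<in> Obj C \<Longrightarrow> ob F X \<in> Obj D"
    and ar_hom: "f \<in> Hom C X Y \<Longrightarrow> ar F f \<in> Hom D (ob F X) (ob F Y)"
    and ar_id: "X \<in> Obj C \<Longrightarrow> ar F (Id C X) = Id D (ob F X)"
    and ar_comp: "\<lbrakk>f \<in> Hom C X Y; g \<in> Hom C Y Z\<rbrakk>
                    \<Longrightarrow> ar F (g \<cdot>\<^bsub>C\<^esub> f) = ar F g \<cdot>\<^bsub>D\<^esub> ar F f"

definition id_fctr :: "('o, 'm, 'o, 'm) fctr" where
  "id_fctr = \<lparr>ob = (\<lambda>X. X), ar = (\<lambda>f. f)\<rparr>"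

definition comp_fctr ::
  "('o2, 'm2, 'o3, 'm3) fctr \<Rightarrow> ('o1, 'm1, 'o2, 'm2) fctr \<Rightarrow> ('o1, 'm1, 'o3, 'm3) fctr"
  (infixr \<open>\<circ>\<^sub>F\<close> 70) where
  "G \<circ>\<^sub>F F = \<lparr>ob = (\<lambda>X. ob G (ob F X)), ar = (\<lambda>f. ar G (ar F f))\<rparr>"

locale nat_trans = F: is_functor C D F + G: is_functor C D G
  for C :: "('o1, 'm1) cat" and D :: "('o2, 'm2) cat"
    and F G :: "('o1, 'm1, 'o2, 'm2) fctr" and \<theta> :: "'o1 \<Rightarrow> 'm2" +
  assumes component_hom: "X \<in> Obj C \<Longrightarrow> \<theta> X \<in> Hom D (ob F X) (ob G X)"
    and naturality: "f \<in> Hom C X Y \<Longrightarrow> \<theta> Y \<cdot>\<^bsub>D\<^esub> ar F f = ar G f \<cdot>\<^bsub>D\<^esub> \<theta> X"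

locale adjunction = F: is_functor C D F + G: is_functor D C G
  for C :: "('o1, 'm1) cat" and D :: "('o2, 'm2) cat"
    and F :: "('o1, 'm1, 'o2, 'm2) fctr" and G :: "('o2, 'm2, 'o1, 'm1) fctr"
    and \<phi> :: "'o1 \<Rightarrow> 'o2 \<Rightarrow> 'm2 \<Rightarrow> 'm1" +
  assumes hom_bij: "\<lbrakk>X \<in> Obj C; Y \<in> Obj D\<rbrakk>
                      \<Longrightarrow> bij_betw (\<phi> X Y) (Hom D (ob F X) Y) (Hom C X (ob G Y))"
    and hom_natural: "\<lbrakk>X \<in> Obj C; Y \<in> Obj D; f \<in> Hom C X' X; g \<in> Hom D Y Y'; h \<in> Hom D (ob F X) Y\<rbrakk>
      \<Longrightarrow> \<phi> X' Y' (g \<cdot>\<^bsub>D\<^esub> h \<cdot>\<^bsub>D\<^esub> ar F f) = ar G g \<cdot>\<^bsub>C\<^esub> \<phi> X Y h \<cdot>\<^bsub>C\<^esub> f"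

definition left_adjoint ::
  "('o1, 'm1) cat \<Rightarrow> ('o2, 'm2) cat \<Rightarrow> ('o1, 'm1, 'o2, 'm2) fctr \<Rightarrow> ('o2, 'm2, 'o1, 'm1) fctr \<Rightarrow> bool"
  where "left_adjoint C D F G \<longleftrightarrow> (\<exists>\<phi>. adjunction C D F G \<phi>)"


section \<open>Algebras and coalgebras\<close>

definition algebra ::
  "('o, 'm) cat \<Rightarrow> ('o, 'm, 'o, 'm) fctr \<Rightarrow> 'o \<Rightarrow> 'm \<Rightarrow> bool" where
  "algebra C F X a \<longleftrightarrow> X \<in> Obj C \<and> a \<in> Hom C (ob F X) X"

definition algebra_morphism ::
  "('o, 'm) cat \<Rightarrow> ('o, 'm, 'o, 'm) fctr \<Rightarrow> 'o \<Rightarrow> 'm \<Rightarrow> 'o \<Rightarrow> 'm \<Rightarrow> 'm \<Rightarrow> bool" where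
  "algebra_morphism C F X a Y b h \<longleftrightarrow> h \<in> Hom C X Y \<and> h \<cdot>\<^bsub>C\<^esub> a = b \<cdot>\<^bsub>C\<^esub> ar F h"

definition initial_algebra ::
  "('o, 'm) cat \<Rightarrow> ('o, 'm, 'o, 'm) fctr \<Rightarrow> 'o \<Rightarrow> 'm \<Rightarrow> bool" where
  "initial_algebra C F X a \<longleftrightarrow> algebra C F X a \<and>
     (\<forall>Y b. algebra C F Y b \<longrightarrow> (\<exists>!h. algebra_morphism C F X a Y b h))"

definition coalgebra ::
  "('o, 'm) cat \<Rightarrow> ('o, 'm, 'o, 'm) fctr \<Rightarrow> 'o \<Rightarrow> 'm \<Rightarrow> bool" where
  "coalgebra C F X c \<longleftrightarrow> X \<in> Obj C \<and> c \<in> Hom C X (ob F X)"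

definition coalgebra_morphism ::
  "('o, 'm) cat \<Rightarrow> ('o, 'm, 'o, 'm) fctr \<Rightarrow> 'o \<Rightarrow> 'm \<Rightarrow> 'o \<Rightarrow> 'm \<Rightarrow> 'm \<Rightarrow> bool" where
  "coalgebra_morphism C F X c Y d h \<longleftrightarrow> h \<in> Hom C X Y \<and> d \<cdot>\<^bsub>C\<^esub> h = ar F h \<cdot>\<^bsub>C\<^esub> c"

definition final_coalgebra ::
  "('o, 'm) cat \<Rightarrow> ('o, 'm, 'o, 'm) fctr \<Rightarrow> 'o \<Rightarrow> 'm \<Rightarrow> bool" where
  "final_coalgebra C F Z z \<longleftrightarrow> coalgebra C F Z z \<and>
     (\<forall>X c. coalgebra C F X c \<longrightarrow> (\<exists>!h. coalgebra_morphism C F X c Z z h))"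

definition coalgebra_to_algebra ::
  "('o, 'm) cat \<Rightarrow> ('o, 'm, 'o, 'm) fctr \<Rightarrow> 'o \<Rightarrow> 'm \<Rightarrow> 'o \<Rightarrow> 'm \<Rightarrow> 'm \<Rightarrow> bool" where
  "coalgebra_to_algebra C F X c Y b h \<longleftrightarrow>
     h \<in> Hom C X Y \<and> h = b \<cdot>\<^bsub>C\<^esub> ar F h \<cdot>\<^bsub>C\<^esub> c"


section \<open>Monads, Kleisli categories, Kleisli laws and monad actions\<close>

locale monad = T: is_functor C C T + \<eta>: nat_trans C C id_fctr T \<eta> + \<mu>: nat_trans C C "T \<circ>\<^sub>F T" T \<mu>
  for C :: "('o, 'm) cat" and T :: "('o, 'm, 'o, 'm) fctr" and \<eta> \<mu> :: "'o \<Rightarrow> 'm" +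
  assumes unit_left: "X \<in> Obj C \<Longrightarrow> \<mu> X \<cdot>\<^bsub>C\<^esub> \<eta> (ob T X) = Id C (ob T X)"
    and unit_right: "X \<in> Obj C \<Longrightarrow> \<mu> X \<cdot>\<^bsub>C\<^esub> ar T (\<eta> X) = Id C (ob T X)"
    and mult_assoc: "X \<in> Obj C \<Longrightarrow> \<mu> X \<cdot>\<^bsub>C\<^esub> \<mu> (ob T X) = \<mu> X \<cdot>\<^bsub>C\<^esub> ar T (\<mu> X)"

text \<open>
  The codomain \<open>Y\<close> of a Kleisli map \<open>f : X \<rightarrow> T Y\<close> cannot be recovered from \<open>f\<close>, as \<open>T\<close> need not be
  injective on objects. A Kleisli arrow is therefore a pair \<open>(Y, f)\<close>.
\<close>

definition kleisli ::
  "('o, 'm) cat \<Rightarrow> ('o, 'm, 'o, 'm) fctr \<Rightarrow> ('o \<Rightarrow> 'm) \<Rightarrow> ('o \<Rightarrow> 'm) \<Rightarrow> ('o, 'o \<times> 'm) cat" where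
  "kleisli C T \<eta> \<mu> =
     \<lparr>Obj = Obj C,
      Arr = {(Y, f). Y \<in> Obj C \<and> f \<in> Arr C \<and> Cod C f = ob T Y},
      Dom = (\<lambda>(Y, f). Dom C f),
      Cod = (\<lambda>(Y, f). Y),
      Id = (\<lambda>X. (X, \<eta> X)),
      Comp = (\<lambda>(Z, g) (Y, f). (Z, \<mu> Z \<cdot>\<^bsub>C\<^esub> ar T g \<cdot>\<^bsub>C\<^esub> f))\<rparr>"

definition kleisli_J :: "('o, 'm) cat \<Rightarrow> ('o \<Rightarrow> 'm) \<Rightarrow> ('o, 'm, 'o, 'o \<times> 'm) fctr" where
  "kleisli_J C \<eta> = \<lparr>ob = (\<lambda>X. X), ar = (\<lambda>f. (Cod C f, \<eta> (Cod C f) \<cdot>\<^bsub>C\<^esub> f))\<rparr>"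

locale kleisli_law = monad C T \<eta> \<mu> + lam: nat_trans C C "A \<circ>\<^sub>F T" "T \<circ>\<^sub>F A" lam + A: is_functor C C A
  for C :: "('o, 'm) cat" and A T :: "('o, 'm, 'o, 'm) fctr" and \<eta> \<mu> lam :: "'o \<Rightarrow> 'm" +
  assumes law_unit: "X \<in> Obj C \<Longrightarrow> lam X \<cdot>\<^bsub>C\<^esub> ar A (\<eta> X) = \<eta> (ob A X)"
    and law_mult: "X \<in> Obj C \<Longrightarrow>
      lam X \<cdot>\<^bsub>C\<^esub> ar A (\<mu> X) = \<mu> (ob A X) \<cdot>\<^bsub>C\<^esub> ar T (lam X) \<cdot>\<^bsub>C\<^esub> lam (ob T X)"

definition kleisli_ext ::
  "('o, 'm) cat \<Rightarrow> ('o, 'm, 'o, 'm) fctr \<Rightarrow> ('o \<Rightarrow> 'm) \<Rightarrow> ('o, 'o \<times> 'm, 'o, 'o \<times> 'm) fctr" where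
  "kleisli_ext C A lam =
     \<lparr>ob = ob A, ar = (\<lambda>(Y, f). (ob A Y, lam Y \<cdot>\<^bsub>C\<^esub> ar A f))\<rparr>"

locale monad_action = monad C T \<eta> \<mu> + G: is_functor B C G + \<tau>: nat_trans B C "T \<circ>\<^sub>F G" G \<tau>
  for B :: "('p, 'n) cat" and C :: "('o, 'm) cat" and T :: "('o, 'm, 'o, 'm) fctr"
    and \<eta> \<mu> :: "'o \<Rightarrow> 'm" and G :: "('p, 'n, 'o, 'm) fctr" and \<tau> :: "'p \<Rightarrow> 'm" +
  assumes act_unit: "Y \<in> Obj B \<Longrightarrow> \<tau> Y \<cdot>\<^bsub>C\<^esub> \<eta> (ob G Y) = Id C (ob G Y)"
    and act_mult: "Y \<in> Obj B \<Longrightarrow> \<tau> Y \<cdot>\<^bsub>C\<^esub> \<mu> (ob G Y) = \<tau> Y \<cdot>\<^bsub>C\<^esub> ar T (\<tau> Y)"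


section \<open>The comparison between Kleisli and logical semantics\<close>

text \<open>
  \<open>\<alpha>\<close> is an arrow \<open>L \<Phi> \<rightarrow> \<Phi>\<close> of \<open>D\<close>. Its inverse, taken in \<open>D\<close>, is an arrow \<open>L \<Phi> \<rightarrow> \<Phi>\<close> of \<open>op_cat D\<close>,
  on which \<open>G\<close> acts covariantly.
\<close>

definition k_map ::
  "('o, 'm) cat \<Rightarrow> ('p, 'n) cat \<Rightarrow> ('p, 'n, 'o, 'm) fctr \<Rightarrow> ('o, 'm, 'o, 'm) fctr \<Rightarrow>
   'o \<Rightarrow> 'm \<Rightarrow> 'p \<Rightarrow> 'n \<Rightarrow> ('p \<Rightarrow> 'm) \<Rightarrow> 'm" where
  "k_map C D G A \<Psi> \<beta> \<Phi> \<alpha> \<delta> =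
     (THE k. algebra_morphism C A \<Psi> \<beta> (ob G \<Phi>) (ar G (inv_arr D \<alpha>) \<cdot>\<^bsub>C\<^esub> \<delta> \<Phi>) k)"

definition k_bar ::
  "('o, 'm) cat \<Rightarrow> ('p, 'n) cat \<Rightarrow> ('p, 'n, 'o, 'm) fctr \<Rightarrow> ('o, 'm, 'o, 'm) fctr \<Rightarrow>
   ('o, 'm, 'o, 'm) fctr \<Rightarrow> 'o \<Rightarrow> 'm \<Rightarrow> 'p \<Rightarrow> 'n \<Rightarrow> ('p \<Rightarrow> 'm) \<Rightarrow> ('p \<Rightarrow> 'm) \<Rightarrow> 'm" where
  "k_bar C D G A T \<Psi> \<beta> \<Phi> \<alpha> \<delta> \<tau> = \<tau> \<Phi> \<cdot>\<^bsub>C\<^esub> ar T (k_map C D G A \<Psi> \<beta> \<Phi> \<alpha> \<delta>)"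

definition ell_kl ::
  "('o, 'm) cat \<Rightarrow> ('o, 'm, 'o, 'm) fctr \<Rightarrow> ('o, 'm, 'o, 'm) fctr \<Rightarrow> ('o \<Rightarrow> 'm) \<Rightarrow> ('o \<Rightarrow> 'm) \<Rightarrow>
   'o \<Rightarrow> 'm \<Rightarrow> 'm" where
  "ell_kl C A T \<mu> lam \<Psi> \<beta> = ar T \<beta> \<cdot>\<^bsub>C\<^esub> \<mu> (ob A \<Psi>) \<cdot>\<^bsub>C\<^esub> ar T (lam \<Psi>)"

definition ell_log ::
  "('o, 'm) cat \<Rightarrow> ('p, 'n) cat \<Rightarrow> ('p, 'n, 'o, 'm) fctr \<Rightarrow> ('o, 'm, 'o, 'm) fctr \<Rightarrow>
   ('p, 'n, 'p, 'n) fctr \<Rightarrow> 'p \<Rightarrow> 'n \<Rightarrow> ('p \<Rightarrow> 'm) \<Rightarrow> ('p \<Rightarrow> 'm) \<Rightarrow> 'm" where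
  "ell_log C D G T L \<Phi> \<alpha> \<delta> \<tau> = ar G (inv_arr D \<alpha>) \<cdot>\<^bsub>C\<^esub> \<tau> (ob L \<Phi>) \<cdot>\<^bsub>C\<^esub> ar T (\<delta> \<Phi>)"

definition kl_map ::
  "('o, 'm) cat \<Rightarrow> ('o, 'm, 'o, 'm) fctr \<Rightarrow> ('o, 'm, 'o, 'm) fctr \<Rightarrow> ('o \<Rightarrow> 'm) \<Rightarrow> ('o \<Rightarrow> 'm) \<Rightarrow>
   'o \<Rightarrow> 'm \<Rightarrow> 'o \<Rightarrow> 'm \<Rightarrow> 'm" where
  "kl_map C A T \<mu> lam \<Psi> \<beta> X c =
     (THE h. coalgebra_to_algebra C (T \<circ>\<^sub>F A) X c (ob T \<Psi>) (ell_kl C A T \<mu> lam \<Psi> \<beta>) h)"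

definition log_map ::
  "('o, 'm) cat \<Rightarrow> ('p, 'n) cat \<Rightarrow> ('p, 'n, 'o, 'm) fctr \<Rightarrow> ('o, 'm, 'o, 'm) fctr \<Rightarrow>
   ('o, 'm, 'o, 'm) fctr \<Rightarrow> ('p, 'n, 'p, 'n) fctr \<Rightarrow> 'p \<Rightarrow> 'n \<Rightarrow> ('p \<Rightarrow> 'm) \<Rightarrow> ('p \<Rightarrow> 'm) \<Rightarrow>
   'o \<Rightarrow> 'm \<Rightarrow> 'm" where
  "log_map C D G A T L \<Phi> \<alpha> \<delta> \<tau> X c =
     (THE h. coalgebra_to_algebra C (T \<circ>\<^sub>F A) X c (ob G \<Phi>) (ell_log C D G T L \<Phi> \<alpha> \<delta> \<tau>) h)"

end

theory Submission
  imports Defs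
begin

text \<open>
  The equation \<open>k_bar \<circ> ell_kl = ell_log \<circ> TA(k_bar)\<close> is a diagram chase through the square defining
  \<open>k\<close>, the multiplication law of \<open>\<tau>\<close>, naturality of \<open>lam\<close> and the compatibility of \<open>\<delta>\<close>, \<open>\<tau>\<close> and
  \<open>lam\<close>. It makes \<open>k_bar \<circ> kl_c\<close> a coalgebra-to-algebra map into \<open>ell_log\<close>, so everything reduces to
  unique existence of \<open>kl_c\<close> and \<open>log_c\<close>. The maps \<open>kl_c\<close> are the coalgebra morphisms into the final
  Kleisli coalgebra, and the maps \<open>log_c\<close> are, under the adjunction, the algebra morphisms out of the
  initial \<open>L\<close>-algebra.
\<close>

section \<open>Rewrite rules without explicit hom-sets\<close>

text \<open>
  Side conditions in terms of \<open>Arr\<close>, \<open>Dom\<close> and \<open>Cod\<close> can be discharged by rewriting, whereas the rules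
  based on \<open>Hom\<close> contain objects that do not occur in the equation.
\<close>

lemma Hom_iff: "f \<in> Hom C X Y \<longleftrightarrow> f \<in> Arr C \<and> Dom C f = X \<and> Cod C f = Y"
  by (auto simp: Hom_def)

context category
begin

lemma id_simps [simp]:
  assumes "X \<in> Obj C"
  shows "Id C X \<in> Arr C" "Dom C (Id C X) = X" "Cod C (Id C X) = X"
  using id_hom[OF assms] by (auto simp: Hom_iff)

lemma comp_simps [simp]:
  assumes "f \<in> Arr C" "g \<in> Arr C" "Dom C g = Cod C f"
  shows "g \<cdot> f \<in> Arr C" "Dom C (g \<cdot> f) = Dom C f" "Cod C (g \<cdot> f) = Cod C g"
  using comp_hom[of f "Dom C f" "Cod C f" g "Cod C g"] assms by (auto simp: Hom_iff)

lemma id_comp [simp]: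
  assumes "f \<in> Arr C" "Cod C f = Y"
  shows "Id C Y \<cdot> f = f"
  using id_left[of f "Dom C f" Y] assms by (auto simp: Hom_iff)

lemma comp_id [simp]:
  assumes "f \<in> Arr C" "Dom C f = X"
  shows "f \<cdot> Id C X = f"
  using id_right[of f X "Cod C f"] assms by (auto simp: Hom_iff)

lemma comp_assoc:
  assumes "f \<in> Arr C" "g \<in> Arr C" "h \<in> Arr C" "Dom C g = Cod C f" "Dom C h = Cod C g"
  shows "(h \<cdot> g) \<cdot> f = h \<cdot> g \<cdot> f"
  using assoc[of f "Dom C f" "Cod C f" g "Cod C g" h "Cod C h"] assms by (auto simp: Hom_iff)

lemma inv_arr_eq:
  assumes "inverse_arrows C f g"
  shows "inv_arr C f = g"
  unfolding inv_arr_def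
proof (rule the_equality[where P = "inverse_arrows C f", OF assms])
  fix h assume h: "inverse_arrows C f h"
  have "h = h \<cdot> f \<cdot> g"
    using assms h by (simp add: inverse_arrows_def Hom_iff)
  also have "\<dots> = (h \<cdot> f) \<cdot> g"
    using assms h
    by (intro comp_assoc[symmetric]) (auto simp: inverse_arrows_def Hom_iff)
  also have "\<dots> = g"
    using assms h by (simp add: inverse_arrows_def Hom_iff)
  finally show "h = g" .
qed

end

lemma op_cat_simps [simp]:
  "Obj (op_cat C) = Obj C" "Arr (op_cat C) = Arr C" "Dom (op_cat C) = Cod C"
  "Cod (op_cat C) = Dom C" "Id (op_cat C) = Id C" "g \<cdot>\<^bsub>op_cat C\<^esub> f = f \<cdot>\<^bsub>C\<^esub> g"
  by (simp_all add: op_cat_def)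

lemma comp_fctr_simps [simp]:
  "ob (G \<circ>\<^sub>F F) X = ob G (ob F X)" "ar (G \<circ>\<^sub>F F) f = ar G (ar F f)"
  by (simp_all add: comp_fctr_def)

lemma id_fctr_simps [simp]: "ob id_fctr X = X" "ar id_fctr f = f"
  by (simp_all add: id_fctr_def)

context is_functor
begin

lemma ar_simps [simp]:
  assumes "f \<in> Arr C"
  shows "ar F f \<in> Arr D" "Dom D (ar F f) = ob F (Dom C f)" "Cod D (ar F f) = ob F (Cod C f)"
  using ar_hom[of f "Dom C f" "Cod C f"] assms by (auto simp: Hom_iff)

lemma ar_comp_Arr:
  assumes "f \<in> Arr C" "g \<in> Arr C" "Dom C g = Cod C f"
  shows "ar F (g \<cdot>\<^bsub>C\<^esub> f) = ar F g \<cdot>\<^bsub>D\<^esub> ar F f"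
  using ar_comp[of f "Dom C f" "Cod C f" g "Cod C g"] assms by (auto simp: Hom_iff)

end

lemma comp_functor:
  assumes "is_functor C D F" "is_functor D E G"
  shows "is_functor C E (G \<circ>\<^sub>F F)"
proof -
  interpret F: is_functor C D F by fact
  interpret G: is_functor D E G by fact
  show ?thesis
    by unfold_locales
      (auto simp: Hom_iff F.ob_obj G.ob_obj F.ar_id G.ar_id F.ar_comp_Arr G.ar_comp_Arr)
qed

context nat_trans
begin

lemma component_simps [simp]:
  assumes "X \<in> Obj C"
  shows "\<theta> X \<in> Arr D" "Dom D (\<theta> X) = ob F X" "Cod D (\<theta> X) = ob G X"
  using component_hom[OF assms] by (auto simp: Hom_iff)

lemma naturality_Arr:
  assumes "f \<in> Arr C"
  shows "\<theta> (Cod C f) \<cdot>\<^bsub>D\<^esub> ar F f = ar G f \<cdot>\<^bsub>D\<^esub> \<theta> (Dom C f)"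
  using naturality[of f "Dom C f" "Cod C f"] assms by (auto simp: Hom_iff)

end


section \<open>Initial algebras and coalgebra-to-algebra morphisms\<close>

text \<open>Lambek's lemma: the inverse is the algebra morphism that initiality gives into
  \<open>ar F a\<close> on \<open>ob F X\<close>. It is applied to both \<beta> and
  \<alpha>.\<close>

lemma initial_algebra_inverse:
  assumes "is_functor C C F" and init: "initial_algebra C F X a"
  shows "inverse_arrows C a (inv_arr C a)"
proof -
  interpret F: is_functor C C F by fact
  have X: "X \<in> Obj C" and a: "a \<in> Arr C" "Dom C a = ob F X" "Cod C a = X"
    using init by (auto simp: initial_algebra_def algebra_def Hom_iff)
  have "algebra C F (ob F X) (ar F a)"
    using X a by (auto simp: algebra_def Hom_iff F.ob_obj)
  then obtain h where "algebra_morphism C F X a (ob F X) (ar F a) h"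
    using init unfolding initial_algebra_def by blast
  then have h: "h \<in> Arr C" "Dom C h = X" "Cod C h = ob F X"
    and ha: "h \<cdot>\<^bsub>C\<^esub> a = ar F a \<cdot>\<^bsub>C\<^esub> ar F h"
    by (auto simp: algebra_morphism_def Hom_iff)
  \<comment> \<open>The composite of \<open>a\<close> after \<open>h\<close> and the identity are
    both endomorphisms of the initial algebra, hence equal.\<close>
  have "algebra_morphism C F X a X a (a \<cdot>\<^bsub>C\<^esub> h)"
    using X a h ha by (simp add: algebra_morphism_def Hom_iff F.C.comp_assoc F.ar_comp_Arr)
  moreover have "algebra_morphism C F X a X a (Id C X)"
    using X a by (simp add: algebra_morphism_def Hom_iff F.ar_id)
  moreover have "\<exists>!h. algebra_morphism C F X a X a h"
    using init by (auto simp: initial_algebra_def)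
  ultimately have ah: "a \<cdot>\<^bsub>C\<^esub> h = Id C X"
    by blast
  \<comment> \<open>The other composite needs no second appeal to initiality: by \<open>ha\<close>
    and functoriality it is the image under \<open>F\<close> of the one just computed.\<close>
  have "h \<cdot>\<^bsub>C\<^esub> a = ar F (a \<cdot>\<^bsub>C\<^esub> h)"
    using a h ha by (simp add: F.ar_comp_Arr)
  also have "\<dots> = Id C (ob F X)"
    using X ah by (simp add: F.ar_id)
  finally have "inverse_arrows C a h"
    using a h ah by (simp add: inverse_arrows_def Hom_iff)
  then show ?thesis
    by (simp add: F.C.inv_arr_eq)
qed

text \<open>Unfold the fixed-point equation of \<open>h\<close> once and slide \<open>g\<close>
  across \<open>b\<close>. With \<open>k_bar\<close> as \<open>g\<close>, this carries
  \<open>kl_map\<close> to a solution of the equation that characterizes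
  \<open>log_map\<close>.\<close>

lemma coalgebra_to_algebra_comp:
  assumes "is_functor C C F" and "coalgebra C F X c"
    and b: "b \<in> Hom C (ob F Y) Y" and b': "b' \<in> Hom C (ob F Y') Y'"
    and h: "coalgebra_to_algebra C F X c Y b h"
    and g: "algebra_morphism C F Y b Y' b' g"
  shows "coalgebra_to_algebra C F X c Y' b' (g \<cdot>\<^bsub>C\<^esub> h)"
proof -
  interpret F: is_functor C C F by fact
  have c: "c \<in> Arr C" "Dom C c = X" "Cod C c = ob F X"
    using assms(2) by (auto simp: coalgebra_def Hom_iff)
  have g': "g \<in> Arr C" "Dom C g = Y" "Cod C g = Y'" "g \<cdot>\<^bsub>C\<^esub> b = b' \<cdot>\<^bsub>C\<^esub> ar F g"
    using g by (auto simp: algebra_morphism_def Hom_iff)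
  have h': "h \<in> Arr C" "Dom C h = X" "Cod C h = Y" and heq: "h = b \<cdot>\<^bsub>C\<^esub> ar F h \<cdot>\<^bsub>C\<^esub> c"
    using h unfolding coalgebra_to_algebra_def Hom_iff by blast+
  have "g \<cdot>\<^bsub>C\<^esub> h = g \<cdot>\<^bsub>C\<^esub> b \<cdot>\<^bsub>C\<^esub> ar F h \<cdot>\<^bsub>C\<^esub> c"
    by (rule arg_cong[OF heq])
  also have "\<dots> = (g \<cdot>\<^bsub>C\<^esub> b) \<cdot>\<^bsub>C\<^esub> ar F h \<cdot>\<^bsub>C\<^esub> c"
    using b c g'(1-3) h' by (simp add: Hom_iff F.C.comp_assoc)
  also have "\<dots> = b' \<cdot>\<^bsub>C\<^esub> ar F (g \<cdot>\<^bsub>C\<^esub> h) \<cdot>\<^bsub>C\<^esub> c"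
    using b' c g' h' by (simp add: Hom_iff F.C.comp_assoc F.ar_comp_Arr)
  finally show ?thesis
    using g' h' by (simp add: coalgebra_to_algebra_def Hom_iff)
qed

text \<open>
  The coalgebra \<open>c\<close> induces an \<open>L\<close>-algebra on \<open>F X\<close>, namely the transpose of
  \<open>\<rho> \<circ> H(unit) \<circ> c : X \<rightarrow> G L F X\<close>. Transposition identifies the algebra morphisms \<open>\<Phi> \<rightarrow> F X\<close> with the
  coalgebra-to-algebra morphisms \<open>X \<rightarrow> G \<Phi>\<close>.
\<close>

lemma ex1_coalgebra_to_algebra_adjoint:
  assumes "is_functor D D L" and "left_adjoint C (op_cat D) F G"
    and "is_functor C C H" and "nat_trans (op_cat D) C (H \<circ>\<^sub>F G) (G \<circ>\<^sub>F L) \<rho>"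
    and init: "initial_algebra D L \<Phi> \<alpha>" and "coalgebra C H X c"
  shows "\<exists>!h. coalgebra_to_algebra C H X c (ob G \<Phi>) (ar G (inv_arr D \<alpha>) \<cdot>\<^bsub>C\<^esub> \<rho> \<Phi>) h"
proof -
  obtain \<phi> where "adjunction C (op_cat D) F G \<phi>"
    using assms(2) by (auto simp: left_adjoint_def)
  then interpret adj: adjunction C "op_cat D" F G \<phi> .
  interpret L: is_functor D D L by fact
  interpret H: is_functor C C H by fact
  interpret \<rho>: nat_trans "op_cat D" C "H \<circ>\<^sub>F G" "G \<circ>\<^sub>F L" \<rho> by fact
  let ?a = "inv_arr D \<alpha>"
  have X: "X \<in> Obj C" and c: "c \<in> Arr C" "Dom C c = X" "Cod C c = ob H X"
    using assms(6) by (auto simp: coalgebra_def Hom_iff)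
  have \<Phi>: "\<Phi> \<in> Obj D" and \<alpha>: "\<alpha> \<in> Arr D" "Dom D \<alpha> = ob L \<Phi>" "Cod D \<alpha> = \<Phi>"
    using init by (auto simp: initial_algebra_def algebra_def Hom_iff)
  have a: "?a \<in> Arr D" "Dom D ?a = \<Phi>" "Cod D ?a = ob L \<Phi>"
    and inv: "?a \<cdot>\<^bsub>D\<^esub> \<alpha> = Id D (ob L \<Phi>)" "\<alpha> \<cdot>\<^bsub>D\<^esub> ?a = Id D \<Phi>"
    using initial_algebra_inverse[OF assms(1) init] \<alpha> by (auto simp: inverse_arrows_def Hom_iff)
  have FX: "ob F X \<in> Obj D"
    using adj.F.ob_obj[OF X] by simp
  have LFX: "ob L (ob F X) \<in> Obj D"
    using FX by (rule L.ob_obj)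
  have GFX: "ob G (ob F X) \<in> Obj C"
    using FX adj.G.ob_obj by simp
  \<comment> \<open>An arrow from \<open>ob F X\<close> to \<open>Y\<close> in
    \<open>op_cat D\<close> is an arrow from \<open>Y\<close> to \<open>ob F X\<close> in
    \<open>D\<close>. From here on, transposition is read in \<open>D\<close>.\<close>
  have bij: "bij_betw (\<phi> X Y) (Hom D Y (ob F X)) (Hom C X (ob G Y))" if "Y \<in> Obj D" for Y
    using adj.hom_bij[OF X, of Y] that by (simp add: Hom_def conj_commute)
  \<comment> \<open>Naturality in the second variable alone, with \<open>Id C X\<close> in the
    first. Read in \<open>D\<close>, the arrow \<open>g\<close> acts by precomposition.\<close>
  have nat: "\<phi> X Y' (h \<cdot>\<^bsub>D\<^esub> g) = ar G g \<cdot>\<^bsub>C\<^esub> \<phi> X Y h"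
    if "h \<in> Hom D Y (ob F X)" "g \<in> Hom D Y' Y" for h g Y Y'
  proof -
    have Y: "Y \<in> Obj D"
      using that(1) L.C.dom_obj by (auto simp: Hom_iff)
    have "\<phi> X Y h \<in> Hom C X (ob G Y)"
      using bij_betwE[OF bij[OF Y]] that by blast
    then show ?thesis
      using adj.hom_natural[OF X, of Y "Id C X" X g Y' h] that X Y FX
      by (simp add: Hom_iff adj.F.ar_id)
  qed
  \<comment> \<open>\<open>e\<close> is the unit of the adjunction at \<open>X\<close>. As in the
    Yoneda lemma, it determines every transpose.\<close>
  define e where "e = \<phi> X (ob F X) (Id D (ob F X))"
  have e: "e \<in> Arr C" "Dom C e = X" "Cod C e = ob G (ob F X)"
    using bij_betwE[OF bij[OF FX]] FX by (auto simp: e_def Hom_iff)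
  have \<phi>_eq: "\<phi> X Y u = ar G u \<cdot>\<^bsub>C\<^esub> e" if "u \<in> Hom D Y (ob F X)" for u Y
    using nat[of "Id D (ob F X)" "ob F X" u Y] that FX by (simp add: e_def Hom_iff)
  define r where "r = \<rho> (ob F X) \<cdot>\<^bsub>C\<^esub> ar H e \<cdot>\<^bsub>C\<^esub> c"
  have r: "r \<in> Hom C X (ob G (ob L (ob F X)))"
    using c e FX by (simp add: r_def Hom_iff)
  then obtain b where b: "b \<in> Hom D (ob L (ob F X)) (ob F X)"
    and br: "\<phi> X (ob L (ob F X)) b = r"
    using bij_betw_imp_surj_on[OF bij[OF LFX]] by (metis imageE)
  have alg: "algebra D L (ob F X) b"
    using FX b by (simp add: algebra_def)
  have transpose: "coalgebra_to_algebra C H X c (ob G \<Phi>) (ar G ?a \<cdot>\<^bsub>C\<^esub> \<rho> \<Phi>) (\<phi> X \<Phi> u) \<longleftrightarrow>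
      algebra_morphism D L \<Phi> \<alpha> (ob F X) b u" if u: "u \<in> Hom D \<Phi> (ob F X)" for u
  proof -
    have u': "u \<in> Arr D" "Dom D u = \<Phi>" "Cod D u = ob F X"
      using u by (auto simp: Hom_iff)
    have b': "b \<in> Arr D" "Dom D b = ob L (ob F X)" "Cod D b = ob F X"
      using b by (auto simp: Hom_iff)
    have hom: "b \<cdot>\<^bsub>D\<^esub> ar L u \<cdot>\<^bsub>D\<^esub> ?a \<in> Hom D \<Phi> (ob F X)"
      using u' b' a by (simp add: Hom_iff)
    have natu: "\<rho> \<Phi> \<cdot>\<^bsub>C\<^esub> ar H (ar G u) = ar G (ar L u) \<cdot>\<^bsub>C\<^esub> \<rho> (ob F X)"
      using \<rho>.naturality_Arr[of u] u' by simp
    \<comment> \<open>Unfolding the equation once at a transpose yields a transpose again: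
      naturality of \<rho> isolates \<open>r\<close>, contravariance of \<open>G\<close> merges the
      two images, and \<open>nat\<close> brings the result under \<phi>.\<close>
    have "(ar G ?a \<cdot>\<^bsub>C\<^esub> \<rho> \<Phi>) \<cdot>\<^bsub>C\<^esub> ar H (\<phi> X \<Phi> u) \<cdot>\<^bsub>C\<^esub> c =
        ar G ?a \<cdot>\<^bsub>C\<^esub> (\<rho> \<Phi> \<cdot>\<^bsub>C\<^esub> ar H (ar G u)) \<cdot>\<^bsub>C\<^esub> ar H e \<cdot>\<^bsub>C\<^esub> c"
      using a c e u' \<Phi> by (simp add: \<phi>_eq[OF u] adj.F.C.comp_assoc H.ar_comp_Arr)
    also have "\<dots> = (ar G ?a \<cdot>\<^bsub>C\<^esub> ar G (ar L u)) \<cdot>\<^bsub>C\<^esub> r"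
      unfolding natu r_def using a c e u' FX by (simp add: adj.F.C.comp_assoc)
    also have "ar G ?a \<cdot>\<^bsub>C\<^esub> ar G (ar L u) = ar G (ar L u \<cdot>\<^bsub>D\<^esub> ?a)"
      using adj.G.ar_comp_Arr[of "ar L u" ?a] a u' by simp
    also have "\<dots> \<cdot>\<^bsub>C\<^esub> r = \<phi> X \<Phi> (b \<cdot>\<^bsub>D\<^esub> ar L u \<cdot>\<^bsub>D\<^esub> ?a)"
      using nat[OF b, of "ar L u \<cdot>\<^bsub>D\<^esub> ?a" \<Phi>] a u' br by (simp add: Hom_iff)
    finally have step: "(ar G ?a \<cdot>\<^bsub>C\<^esub> \<rho> \<Phi>) \<cdot>\<^bsub>C\<^esub> ar H (\<phi> X \<Phi> u) \<cdot>\<^bsub>C\<^esub> c =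
        \<phi> X \<Phi> (b \<cdot>\<^bsub>D\<^esub> ar L u \<cdot>\<^bsub>D\<^esub> ?a)" .
    have "\<phi> X \<Phi> u \<in> Hom C X (ob G \<Phi>)"
      using bij_betwE[OF bij[OF \<Phi>]] u by blast
    then have "coalgebra_to_algebra C H X c (ob G \<Phi>) (ar G ?a \<cdot>\<^bsub>C\<^esub> \<rho> \<Phi>) (\<phi> X \<Phi> u) \<longleftrightarrow>
        \<phi> X \<Phi> u = \<phi> X \<Phi> (b \<cdot>\<^bsub>D\<^esub> ar L u \<cdot>\<^bsub>D\<^esub> ?a)"
      by (simp add: coalgebra_to_algebra_def step)
    \<comment> \<open>Both sides are transposes, so injectivity of \<phi> removes it; what remains
      is to move \<open>?a\<close> across the equation as the inverse of \<alpha>.\<close>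
    also have "\<dots> \<longleftrightarrow> u = b \<cdot>\<^bsub>D\<^esub> ar L u \<cdot>\<^bsub>D\<^esub> ?a"
      using inj_on_eq_iff[OF bij_betw_imp_inj_on[OF bij[OF \<Phi>]] u hom] .
    also have "\<dots> \<longleftrightarrow> u \<cdot>\<^bsub>D\<^esub> \<alpha> = b \<cdot>\<^bsub>D\<^esub> ar L u"
    proof
      assume "u = b \<cdot>\<^bsub>D\<^esub> ar L u \<cdot>\<^bsub>D\<^esub> ?a"
      then have "u \<cdot>\<^bsub>D\<^esub> \<alpha> = (b \<cdot>\<^bsub>D\<^esub> ar L u \<cdot>\<^bsub>D\<^esub> ?a) \<cdot>\<^bsub>D\<^esub> \<alpha>"
        by (rule arg_cong)
      also have "\<dots> = b \<cdot>\<^bsub>D\<^esub> ar L u"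
        using a b' u' \<alpha> inv by (simp add: L.C.comp_assoc)
      finally show "u \<cdot>\<^bsub>D\<^esub> \<alpha> = b \<cdot>\<^bsub>D\<^esub> ar L u" .
    next
      assume eq: "u \<cdot>\<^bsub>D\<^esub> \<alpha> = b \<cdot>\<^bsub>D\<^esub> ar L u"
      have "u = u \<cdot>\<^bsub>D\<^esub> \<alpha> \<cdot>\<^bsub>D\<^esub> ?a"
        using inv u' by simp
      also have "\<dots> = (u \<cdot>\<^bsub>D\<^esub> \<alpha>) \<cdot>\<^bsub>D\<^esub> ?a"
        using a \<alpha> u' by (simp add: L.C.comp_assoc)
      also have "\<dots> = b \<cdot>\<^bsub>D\<^esub> ar L u \<cdot>\<^bsub>D\<^esub> ?a"
        unfolding eq using a b' u' by (simp add: L.C.comp_assoc)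
      finally show "u = b \<cdot>\<^bsub>D\<^esub> ar L u \<cdot>\<^bsub>D\<^esub> ?a" .
    qed
    finally show ?thesis
      using u by (simp add: algebra_morphism_def)
  qed
  have ex1: "\<exists>!u. algebra_morphism D L \<Phi> \<alpha> (ob F X) b u"
    using init alg by (auto simp: initial_algebra_def)
  then obtain u where u: "algebra_morphism D L \<Phi> \<alpha> (ob F X) b u"
    by blast
  show ?thesis
  proof (rule ex1I)
    show "coalgebra_to_algebra C H X c (ob G \<Phi>) (ar G ?a \<cdot>\<^bsub>C\<^esub> \<rho> \<Phi>) (\<phi> X \<Phi> u)"
      using transpose u by (simp add: algebra_morphism_def)
  next
    \<comment> \<open>Every solution is a transpose because \<phi> is surjective, so its uniqueness
      is inherited from that of the algebra morphism.\<close>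
    fix h assume h: "coalgebra_to_algebra C H X c (ob G \<Phi>) (ar G ?a \<cdot>\<^bsub>C\<^esub> \<rho> \<Phi>) h"
    then have "h \<in> Hom C X (ob G \<Phi>)"
      by (simp add: coalgebra_to_algebra_def)
    then obtain v where v: "v \<in> Hom D \<Phi> (ob F X)" "h = \<phi> X \<Phi> v"
      using bij_betw_imp_surj_on[OF bij[OF \<Phi>]] by (metis imageE)
    then have "algebra_morphism D L \<Phi> \<alpha> (ob F X) b v"
      using h transpose by simp
    then show "h = \<phi> X \<Phi> u"
      using ex1 u v by blast
  qed
qed


section \<open>Kleisli semantics\<close>

lemma Hom_kleisli:
  "f \<in> Hom (kleisli C T \<eta> \<mu>) X Y \<longleftrightarrow> fst f = Y \<and> Y \<in> Obj C \<and> snd f \<in> Hom C X (ob T Y)"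
  by (auto simp: kleisli_def Hom_def split: prod.splits)

lemma comp_kleisli:
  "(Z, g) \<cdot>\<^bsub>kleisli C T \<eta> \<mu>\<^esub> (Y, f) = (Z, \<mu> Z \<cdot>\<^bsub>C\<^esub> ar T g \<cdot>\<^bsub>C\<^esub> f)"
  by (simp add: kleisli_def)

context kleisli_law
begin

lemma ell_kl_Hom:
  assumes "\<Psi> \<in> Obj C" "\<beta> \<in> Hom C (ob A \<Psi>) \<Psi>"
  shows "ell_kl C A T \<mu> lam \<Psi> \<beta> \<in> Hom C (ob T (ob A (ob T \<Psi>))) (ob T \<Psi>)"
  using assms by (simp add: ell_kl_def Hom_iff A.ob_obj)

text \<open>The monad unit law collapses the Kleisli composite of \<open>J(\<beta>^-1)\<close> after
  \<open>h\<close> to \<open>T(\<beta>^-1)\<close> after \<open>h\<close>. As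
  \<open>T(\<beta>)\<close> is invertible, it can be moved to the other side, which turns the
  coalgebra square into the fixed-point equation for \<open>ell_kl\<close>.\<close>

lemma kleisli_coalgebra_morphism_iff:
  assumes inv: "inverse_arrows C \<beta> (inv_arr C \<beta>)" and "\<Psi> \<in> Obj C" and "\<beta> \<in> Hom C (ob A \<Psi>) \<Psi>"
    and "coalgebra C (T \<circ>\<^sub>F A) X c" and "h \<in> Hom C X (ob T \<Psi>)"
  shows "coalgebra_morphism (kleisli C T \<eta> \<mu>) (kleisli_ext C A lam) X (ob A X, c)
      \<Psi> (ar (kleisli_J C \<eta>) (inv_arr C \<beta>)) (\<Psi>, h) \<longleftrightarrow>
    coalgebra_to_algebra C (T \<circ>\<^sub>F A) X c (ob T \<Psi>) (ell_kl C A T \<mu> lam \<Psi> \<beta>) h"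
proof -
  let ?b = "inv_arr C \<beta>"
  have \<Psi>: "\<Psi> \<in> Obj C" "ob A \<Psi> \<in> Obj C" "ob T (ob A \<Psi>) \<in> Obj C"
    using assms(2) by (simp_all add: A.ob_obj T.ob_obj)
  have \<beta>: "\<beta> \<in> Arr C" "Dom C \<beta> = ob A \<Psi>" "Cod C \<beta> = \<Psi>"
    using assms(3) by (auto simp: Hom_iff)
  have b: "?b \<in> Arr C" "Dom C ?b = \<Psi>" "Cod C ?b = ob A \<Psi>"
    and b\<beta>: "?b \<cdot>\<^bsub>C\<^esub> \<beta> = Id C (ob A \<Psi>)" "\<beta> \<cdot>\<^bsub>C\<^esub> ?b = Id C \<Psi>"
    using inv \<beta> by (auto simp: inverse_arrows_def Hom_iff)
  have X: "X \<in> Obj C" and c: "c \<in> Arr C" "Dom C c = X" "Cod C c = ob T (ob A X)"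
    using assms(4) by (auto simp: coalgebra_def Hom_iff)
  have h: "h \<in> Arr C" "Dom C h = X" "Cod C h = ob T \<Psi>"
    using assms(5) by (auto simp: Hom_iff)
  have Tb: "ar T \<beta> \<cdot>\<^bsub>C\<^esub> ar T ?b = Id C (ob T \<Psi>)" "ar T ?b \<cdot>\<^bsub>C\<^esub> ar T \<beta> = Id C (ob T (ob A \<Psi>))"
    using b \<beta> b\<beta> \<Psi> by (simp_all add: T.ar_comp_Arr[symmetric] T.ar_id)
  \<comment> \<open>\<open>s\<close> is the underlying map of the other leg of the square: the
    Kleisli extension of \<open>A\<close> applied to \<open>h\<close>, composed after
    \<open>c\<close>.\<close>
  define s where "s = \<mu> (ob A \<Psi>) \<cdot>\<^bsub>C\<^esub> ar T (lam \<Psi> \<cdot>\<^bsub>C\<^esub> ar A h) \<cdot>\<^bsub>C\<^esub> c"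
  have s: "s \<in> Arr C" "Dom C s = X" "Cod C s = ob T (ob A \<Psi>)"
    using h c \<Psi> by (simp_all add: s_def)
  have "\<mu> (ob A \<Psi>) \<cdot>\<^bsub>C\<^esub> ar T (\<eta> (ob A \<Psi>) \<cdot>\<^bsub>C\<^esub> ?b) \<cdot>\<^bsub>C\<^esub> h =
      (\<mu> (ob A \<Psi>) \<cdot>\<^bsub>C\<^esub> ar T (\<eta> (ob A \<Psi>))) \<cdot>\<^bsub>C\<^esub> ar T ?b \<cdot>\<^bsub>C\<^esub> h"
    using b h \<Psi> by (simp add: T.C.comp_assoc T.ar_comp_Arr)
  also have "\<dots> = ar T ?b \<cdot>\<^bsub>C\<^esub> h"
    using b h \<Psi> by (simp add: unit_right)
  finally have "coalgebra_morphism (kleisli C T \<eta> \<mu>) (kleisli_ext C A lam) X (ob A X, c)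
      \<Psi> (ar (kleisli_J C \<eta>) ?b) (\<Psi>, h) \<longleftrightarrow> ar T ?b \<cdot>\<^bsub>C\<^esub> h = s"
    using b assms(5) \<Psi>
    by (simp add: coalgebra_morphism_def Hom_kleisli kleisli_J_def kleisli_ext_def comp_kleisli
        s_def)
  also have "\<dots> \<longleftrightarrow> h = ar T \<beta> \<cdot>\<^bsub>C\<^esub> s"
  proof
    assume "ar T ?b \<cdot>\<^bsub>C\<^esub> h = s"
    then have "ar T \<beta> \<cdot>\<^bsub>C\<^esub> s = (ar T \<beta> \<cdot>\<^bsub>C\<^esub> ar T ?b) \<cdot>\<^bsub>C\<^esub> h"
      using b \<beta> h by (auto simp add: T.C.comp_assoc)
    then show "h = ar T \<beta> \<cdot>\<^bsub>C\<^esub> s"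
      using Tb h by simp
  next
    assume "h = ar T \<beta> \<cdot>\<^bsub>C\<^esub> s"
    then have "ar T ?b \<cdot>\<^bsub>C\<^esub> h = (ar T ?b \<cdot>\<^bsub>C\<^esub> ar T \<beta>) \<cdot>\<^bsub>C\<^esub> s"
      using b \<beta> s by (simp add: T.C.comp_assoc)
    then show "ar T ?b \<cdot>\<^bsub>C\<^esub> h = s"
      using Tb s by simp
  qed
  also have "ar T \<beta> \<cdot>\<^bsub>C\<^esub> s = ell_kl C A T \<mu> lam \<Psi> \<beta> \<cdot>\<^bsub>C\<^esub> ar (T \<circ>\<^sub>F A) h \<cdot>\<^bsub>C\<^esub> c"
    using \<beta> h c \<Psi> by (simp add: s_def ell_kl_def T.C.comp_assoc T.ar_comp_Arr)
  finally show ?thesis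
    using assms(5) by (simp add: coalgebra_to_algebra_def)
qed

lemma ex1_coalgebra_to_algebra_kleisli:
  assumes "inverse_arrows C \<beta> (inv_arr C \<beta>)" and "\<Psi> \<in> Obj C" and "\<beta> \<in> Hom C (ob A \<Psi>) \<Psi>"
    and final: "final_coalgebra (kleisli C T \<eta> \<mu>) (kleisli_ext C A lam)
      \<Psi> (ar (kleisli_J C \<eta>) (inv_arr C \<beta>))"
    and X: "coalgebra C (T \<circ>\<^sub>F A) X c"
  shows "\<exists>!h. coalgebra_to_algebra C (T \<circ>\<^sub>F A) X c (ob T \<Psi>) (ell_kl C A T \<mu> lam \<Psi> \<beta>) h"
proof -
  let ?M = "coalgebra_morphism (kleisli C T \<eta> \<mu>) (kleisli_ext C A lam) X (ob A X, c)
      \<Psi> (ar (kleisli_J C \<eta>) (inv_arr C \<beta>))"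
  let ?Q = "coalgebra_to_algebra C (T \<circ>\<^sub>F A) X c (ob T \<Psi>) (ell_kl C A T \<mu> lam \<Psi> \<beta>)"
  have "coalgebra (kleisli C T \<eta> \<mu>) (kleisli_ext C A lam) X (ob A X, c)"
    using X by (simp add: coalgebra_def Hom_kleisli kleisli_ext_def A.ob_obj) (simp add: kleisli_def)
  then have ex1: "\<exists>!f. ?M f"
    using final by (auto simp: final_coalgebra_def)
  \<comment> \<open>The first component of a Kleisli arrow is forced by its codomain, so dropping it
    loses nothing and unique existence passes from pairs to maps of \<open>C\<close>.\<close>
  have "?M f \<Longrightarrow> f = (\<Psi>, snd f) \<and> snd f \<in> Hom C X (ob T \<Psi>)" for f
    by (cases f) (auto simp: coalgebra_morphism_def Hom_kleisli)
  moreover have "?Q h \<Longrightarrow> h \<in> Hom C X (ob T \<Psi>)" for h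
    by (simp add: coalgebra_to_algebra_def)
  moreover have "?M (\<Psi>, h) \<longleftrightarrow> ?Q h" if "h \<in> Hom C X (ob T \<Psi>)" for h
    using kleisli_coalgebra_morphism_iff assms that by blast
  ultimately show ?thesis
    using ex1 by (metis snd_conv)
qed

end

section \<open>The comparison square and its consequence for coalgebras\<close>

theorem theorem7p9:
  fixes C :: "('o, 'm) cat" and D :: "('p, 'n) cat"
    and F :: "('o, 'm, 'p, 'n) fctr" and G :: "('p, 'n, 'o, 'm) fctr"
    and A T :: "('o, 'm, 'o, 'm) fctr" and L :: "('p, 'n, 'p, 'n) fctr"
    and \<Psi> :: 'o and \<beta> :: 'm and \<Phi> :: 'p and \<alpha> :: 'n
    and \<eta> \<mu> lam :: "'o \<Rightarrow> 'm" and \<delta> \<tau> :: "'p \<Rightarrow> 'm"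
  assumes "category C" and "category D"
    and "is_functor C (op_cat D) F" and "is_functor (op_cat D) C G"
    and "left_adjoint C (op_cat D) F G"
    and "is_functor C C A" and "initial_algebra C A \<Psi> \<beta>"
    and "monad C T \<eta> \<mu>"
    and "kleisli_law C A T \<eta> \<mu> lam"
    and "final_coalgebra (kleisli C T \<eta> \<mu>) (kleisli_ext C A lam)
           \<Psi> (ar (kleisli_J C \<eta>) (inv_arr C \<beta>))"
    and "is_functor D D L" and "initial_algebra D L \<Phi> \<alpha>"
    and "nat_trans (op_cat D) C (A \<circ>\<^sub>F G) (G \<circ>\<^sub>F L) \<delta>"
    and "monad_action (op_cat D) C T \<eta> \<mu> G \<tau>"
    and "\<And>Y. Y \<in> Obj D \<Longrightarrow>
           \<delta> Y \<cdot>\<^bsub>C\<^esub> ar A (\<tau> Y) = \<tau> (ob L Y) \<cdot>\<^bsub>C\<^esub> ar T (\<delta> Y) \<cdot>\<^bsub>C\<^esub> lam (ob G Y)"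
  shows "(\<exists>!k. algebra_morphism C A \<Psi> \<beta> (ob G \<Phi>) (ar G (inv_arr D \<alpha>) \<cdot>\<^bsub>C\<^esub> \<delta> \<Phi>) k) \<and>
    k_bar C D G A T \<Psi> \<beta> \<Phi> \<alpha> \<delta> \<tau> \<cdot>\<^bsub>C\<^esub> ell_kl C A T \<mu> lam \<Psi> \<beta> =
      ell_log C D G T L \<Phi> \<alpha> \<delta> \<tau> \<cdot>\<^bsub>C\<^esub> ar (T \<circ>\<^sub>F A) (k_bar C D G A T \<Psi> \<beta> \<Phi> \<alpha> \<delta> \<tau>) \<and>
    (\<forall>X c. coalgebra C (T \<circ>\<^sub>F A) X c \<longrightarrow>
       (\<exists>!h. coalgebra_to_algebra C (T \<circ>\<^sub>F A) X c (ob T \<Psi>) (ell_kl C A T \<mu> lam \<Psi> \<beta>) h) \<and>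
       (\<exists>!h. coalgebra_to_algebra C (T \<circ>\<^sub>F A) X c (ob G \<Phi>) (ell_log C D G T L \<Phi> \<alpha> \<delta> \<tau>) h) \<and>
       k_bar C D G A T \<Psi> \<beta> \<Phi> \<alpha> \<delta> \<tau> \<cdot>\<^bsub>C\<^esub> kl_map C A T \<mu> lam \<Psi> \<beta> X c =
         log_map C D G A T L \<Phi> \<alpha> \<delta> \<tau> X c)"
proof -
  interpret A: is_functor C C A by fact
  interpret K: kleisli_law C A T \<eta> \<mu> lam by fact
  interpret L: is_functor D D L by fact
  interpret \<delta>: nat_trans "op_cat D" C "A \<circ>\<^sub>F G" "G \<circ>\<^sub>F L" \<delta> by fact
  interpret act: monad_action "op_cat D" C T \<eta> \<mu> G \<tau> by fact
  note compat = assms(15)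
  let ?a = "inv_arr D \<alpha>" and ?k = "k_map C D G A \<Psi> \<beta> \<Phi> \<alpha> \<delta>"
  let ?kb = "k_bar C D G A T \<Psi> \<beta> \<Phi> \<alpha> \<delta> \<tau>"
  let ?lkl = "ell_kl C A T \<mu> lam \<Psi> \<beta>" and ?llog = "ell_log C D G T L \<Phi> \<alpha> \<delta> \<tau>"
  have TA: "is_functor C C (T \<circ>\<^sub>F A)"
    by (rule comp_functor) (rule assms K.T.is_functor_axioms)+
  have \<Psi>: "\<Psi> \<in> Obj C" "ob A \<Psi> \<in> Obj C"
    and \<beta>_hom: "\<beta> \<in> Hom C (ob A \<Psi>) \<Psi>"
    using assms(7) by (auto simp: initial_algebra_def algebra_def A.ob_obj)
  then have \<beta>: "\<beta> \<in> Arr C" "Dom C \<beta> = ob A \<Psi>" "Cod C \<beta> = \<Psi>"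
    by (auto simp: Hom_iff)
  have \<Phi>: "\<Phi> \<in> Obj D" "ob L \<Phi> \<in> Obj D"
    and \<alpha>: "\<alpha> \<in> Arr D" "Dom D \<alpha> = ob L \<Phi>" "Cod D \<alpha> = \<Phi>"
    using assms(12) by (auto simp: initial_algebra_def algebra_def Hom_iff L.ob_obj)
  have a: "?a \<in> Arr D" "Dom D ?a = \<Phi>" "Cod D ?a = ob L \<Phi>"
    using initial_algebra_inverse[OF assms(11,12)] \<alpha> by (auto simp: inverse_arrows_def Hom_iff)
  have G\<Phi>: "ob G \<Phi> \<in> Obj C" "ob G (ob L \<Phi>) \<in> Obj C" "ob A (ob G \<Phi>) \<in> Obj C"
    using \<Phi> act.G.ob_obj A.ob_obj by auto
  have Ga: "ar G ?a \<in> Arr C" "Dom C (ar G ?a) = ob G (ob L \<Phi>)" "Cod C (ar G ?a) = ob G \<Phi>"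
    using act.G.ar_simps[of ?a] a by simp_all
  have \<delta>\<Phi>: "\<delta> \<Phi> \<in> Arr C" "Dom C (\<delta> \<Phi>) = ob A (ob G \<Phi>)" "Cod C (\<delta> \<Phi>) = ob G (ob L \<Phi>)"
    using \<delta>.component_simps[of \<Phi>] \<Phi> by simp_all
  have \<tau>: "\<tau> Y \<in> Arr C" "Dom C (\<tau> Y) = ob T (ob G Y)" "Cod C (\<tau> Y) = ob G Y" if "Y \<in> Obj D" for Y
    using act.\<tau>.component_simps[of Y] that by simp_all

  have ex1_k: "\<exists>!k. algebra_morphism C A \<Psi> \<beta> (ob G \<Phi>) (ar G ?a \<cdot>\<^bsub>C\<^esub> \<delta> \<Phi>) k"
  proof -
    have "algebra C A (ob G \<Phi>) (ar G ?a \<cdot>\<^bsub>C\<^esub> \<delta> \<Phi>)"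
      using G\<Phi> Ga \<delta>\<Phi> by (simp add: algebra_def Hom_iff)
    then show ?thesis
      using assms(7) by (auto simp: initial_algebra_def)
  qed
  have "algebra_morphism C A \<Psi> \<beta> (ob G \<Phi>) (ar G ?a \<cdot>\<^bsub>C\<^esub> \<delta> \<Phi>) ?k"
    unfolding k_map_def by (rule theI'[OF ex1_k])
  then have k: "?k \<in> Arr C" "Dom C ?k = \<Psi>" "Cod C ?k = ob G \<Phi>"
    and k\<beta>: "?k \<cdot>\<^bsub>C\<^esub> \<beta> = (ar G ?a \<cdot>\<^bsub>C\<^esub> \<delta> \<Phi>) \<cdot>\<^bsub>C\<^esub> ar A ?k"
    by (auto simp: algebra_morphism_def Hom_iff)
  note typing = \<Psi> \<beta> \<Phi> a G\<Phi> Ga \<delta>\<Phi> \<tau> k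

  have square: "?kb \<cdot>\<^bsub>C\<^esub> ?lkl = ?llog \<cdot>\<^bsub>C\<^esub> ar (T \<circ>\<^sub>F A) ?kb"
  proof -
    \<comment> \<open>In \<open>op_cat D\<close> the arrow \<open>?a\<close> runs from
      \<open>ob L \<Phi>\<close> to \<Phi>, which fixes the direction of this square.\<close>
    have nat_\<tau>: "\<tau> \<Phi> \<cdot>\<^bsub>C\<^esub> ar T (ar G ?a) = ar G ?a \<cdot>\<^bsub>C\<^esub> \<tau> (ob L \<Phi>)"
      using act.\<tau>.naturality_Arr[of ?a] a by simp
    have nat_\<mu>: "ar T g \<cdot>\<^bsub>C\<^esub> \<mu> (Dom C g) = \<mu> (Cod C g) \<cdot>\<^bsub>C\<^esub> ar T (ar T g)" if "g \<in> Arr C" for g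
      using K.\<mu>.naturality_Arr[OF that] by simp
    have nat_lam: "ar T (ar A ?k) \<cdot>\<^bsub>C\<^esub> lam \<Psi> = lam (ob G \<Phi>) \<cdot>\<^bsub>C\<^esub> ar A (ar T ?k)"
      using K.lam.naturality_Arr[of ?k] k by simp
    have act_mult: "\<tau> (ob L \<Phi>) \<cdot>\<^bsub>C\<^esub> \<mu> (ob G (ob L \<Phi>)) = \<tau> (ob L \<Phi>) \<cdot>\<^bsub>C\<^esub> ar T (\<tau> (ob L \<Phi>))"
      using act.act_mult[of "ob L \<Phi>"] \<Phi> by simp
    \<comment> \<open>After \<open>k\<beta>\<close> is used, \<open>?d\<close> is everything between
      \<open>G(\<alpha>^-1)\<close> and \<mu>; naming it lets it cross \<mu> in a single naturality
      step.\<close>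
    let ?d = "\<delta> \<Phi> \<cdot>\<^bsub>C\<^esub> ar A ?k"
    have d: "?d \<in> Arr C" "Dom C ?d = ob A \<Psi>" "Cod C ?d = ob G (ob L \<Phi>)"
      using typing by simp_all
    have "?kb \<cdot>\<^bsub>C\<^esub> ?lkl = \<tau> \<Phi> \<cdot>\<^bsub>C\<^esub> ar T (?k \<cdot>\<^bsub>C\<^esub> \<beta>) \<cdot>\<^bsub>C\<^esub> \<mu> (ob A \<Psi>) \<cdot>\<^bsub>C\<^esub> ar T (lam \<Psi>)"
      using typing by (simp add: k_bar_def ell_kl_def A.C.comp_assoc K.T.ar_comp_Arr)
    also have "\<dots> = (\<tau> \<Phi> \<cdot>\<^bsub>C\<^esub> ar T (ar G ?a)) \<cdot>\<^bsub>C\<^esub> (ar T ?d \<cdot>\<^bsub>C\<^esub> \<mu> (ob A \<Psi>)) \<cdot>\<^bsub>C\<^esub> ar T (lam \<Psi>)"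
      unfolding k\<beta> using typing by (simp add: A.C.comp_assoc K.T.ar_comp_Arr)
    also have "ar T ?d \<cdot>\<^bsub>C\<^esub> \<mu> (ob A \<Psi>) = \<mu> (ob G (ob L \<Phi>)) \<cdot>\<^bsub>C\<^esub> ar T (ar T ?d)"
      using nat_\<mu>[OF d(1)] d(2,3) by simp
    also have "(\<tau> \<Phi> \<cdot>\<^bsub>C\<^esub> ar T (ar G ?a)) \<cdot>\<^bsub>C\<^esub> (\<mu> (ob G (ob L \<Phi>)) \<cdot>\<^bsub>C\<^esub> ar T (ar T ?d)) \<cdot>\<^bsub>C\<^esub> ar T (lam \<Psi>) =
        ar G ?a \<cdot>\<^bsub>C\<^esub> (\<tau> (ob L \<Phi>) \<cdot>\<^bsub>C\<^esub> \<mu> (ob G (ob L \<Phi>))) \<cdot>\<^bsub>C\<^esub> ar T (ar T ?d \<cdot>\<^bsub>C\<^esub> lam \<Psi>)"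
      unfolding nat_\<tau> using typing d by (simp add: A.C.comp_assoc K.T.ar_comp_Arr)
    also have "ar T ?d \<cdot>\<^bsub>C\<^esub> lam \<Psi> = ar T (\<delta> \<Phi>) \<cdot>\<^bsub>C\<^esub> ar T (ar A ?k) \<cdot>\<^bsub>C\<^esub> lam \<Psi>"
      using typing by (simp add: A.C.comp_assoc K.T.ar_comp_Arr)
    \<comment> \<open>Naturality of \<open>lam\<close> moves \<open>k\<close> to the right of
      \<open>lam\<close>, and the action law trades \<mu> for a second \<tau> under
      \<open>T\<close>. This exposes the right-hand side of \<open>compat\<close>.\<close>
    also have "ar G ?a \<cdot>\<^bsub>C\<^esub> (\<tau> (ob L \<Phi>) \<cdot>\<^bsub>C\<^esub> \<mu> (ob G (ob L \<Phi>))) \<cdot>\<^bsub>C\<^esub> ar T \<dots> =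
        ar G ?a \<cdot>\<^bsub>C\<^esub> \<tau> (ob L \<Phi>) \<cdot>\<^bsub>C\<^esub>
          ar T ((\<tau> (ob L \<Phi>) \<cdot>\<^bsub>C\<^esub> ar T (\<delta> \<Phi>) \<cdot>\<^bsub>C\<^esub> lam (ob G \<Phi>)) \<cdot>\<^bsub>C\<^esub> ar A (ar T ?k))"
      unfolding nat_lam act_mult using typing by (simp add: A.C.comp_assoc K.T.ar_comp_Arr)
    \<comment> \<open>Read from right to left, \<open>compat\<close> produces \<delta> after
      \<open>A(\<tau>)\<close>; the latter joins \<open>A(T(k))\<close> to form \<open>A\<close> of
      \<open>k_bar\<close>.\<close>
    also have "\<dots> = ?llog \<cdot>\<^bsub>C\<^esub> ar (T \<circ>\<^sub>F A) ?kb"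
      unfolding compat[OF \<Phi>(1), symmetric] ell_log_def k_bar_def using typing
      by (simp add: A.C.comp_assoc K.T.ar_comp_Arr A.ar_comp_Arr)
    finally show ?thesis .
  qed

  \<comment> \<open>This family exhibits \<open>ell_log\<close> as \<open>G(\<alpha>^-1)\<close>
    after a component at \<Phi>, the shape required by
    \<open>ex1_coalgebra_to_algebra_adjoint\<close> with \<open>T \<circ>\<^sub>F A\<close> as the
    endofunctor.\<close>
  have \<rho>: "nat_trans (op_cat D) C ((T \<circ>\<^sub>F A) \<circ>\<^sub>F G) (G \<circ>\<^sub>F L) (\<lambda>Y. \<tau> (ob L Y) \<cdot>\<^bsub>C\<^esub> ar T (\<delta> Y))"
  proof (intro nat_trans.intro nat_trans_axioms.intro)
    show "is_functor (op_cat D) C ((T \<circ>\<^sub>F A) \<circ>\<^sub>F G)"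
      using assms(4) TA by (rule comp_functor)
    show "is_functor (op_cat D) C (G \<circ>\<^sub>F L)"
      by (rule \<delta>.G.is_functor_axioms)
  next
    fix Y assume "Y \<in> Obj (op_cat D)"
    then show "\<tau> (ob L Y) \<cdot>\<^bsub>C\<^esub> ar T (\<delta> Y) \<in> Hom C (ob ((T \<circ>\<^sub>F A) \<circ>\<^sub>F G) Y) (ob (G \<circ>\<^sub>F L) Y)"
      by (simp add: Hom_iff L.ob_obj \<tau>)
  next
    fix f Y Z assume "f \<in> Hom (op_cat D) Y Z"
    then have f: "f \<in> Arr D" "Cod D f = Y" "Dom D f = Z"
      by (auto simp: Hom_iff)
    then have YZ: "Y \<in> Obj D" "Z \<in> Obj D" "ob L Y \<in> Obj D" "ob L Z \<in> Obj D"
      using L.C.cod_obj L.C.dom_obj L.ob_obj by auto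
    \<comment> \<open>In \<open>D\<close> the arrow \<open>f\<close> runs from \<open>Z\<close> to
      \<open>Y\<close>, so its image under \<open>G\<close> runs from \<open>ob G Y\<close> to
      \<open>ob G Z\<close>.\<close>
    have nat_\<delta>: "\<delta> Z \<cdot>\<^bsub>C\<^esub> ar A (ar G f) = ar G (ar L f) \<cdot>\<^bsub>C\<^esub> \<delta> Y"
      using \<delta>.naturality_Arr[of f] f by simp
    have nat_\<tau>: "\<tau> (ob L Z) \<cdot>\<^bsub>C\<^esub> ar T (ar G (ar L f)) = ar G (ar L f) \<cdot>\<^bsub>C\<^esub> \<tau> (ob L Y)"
      using act.\<tau>.naturality_Arr[of "ar L f"] f by simp
    have "(\<tau> (ob L Z) \<cdot>\<^bsub>C\<^esub> ar T (\<delta> Z)) \<cdot>\<^bsub>C\<^esub> ar T (ar A (ar G f)) =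
        \<tau> (ob L Z) \<cdot>\<^bsub>C\<^esub> ar T (\<delta> Z \<cdot>\<^bsub>C\<^esub> ar A (ar G f))"
      using f YZ by (simp add: A.C.comp_assoc K.T.ar_comp_Arr \<tau>)
    also have "\<dots> = (\<tau> (ob L Z) \<cdot>\<^bsub>C\<^esub> ar T (ar G (ar L f))) \<cdot>\<^bsub>C\<^esub> ar T (\<delta> Y)"
      unfolding nat_\<delta> using f YZ by (simp add: A.C.comp_assoc K.T.ar_comp_Arr \<tau>)
    also have "\<dots> = ar G (ar L f) \<cdot>\<^bsub>C\<^esub> \<tau> (ob L Y) \<cdot>\<^bsub>C\<^esub> ar T (\<delta> Y)"
      unfolding nat_\<tau> using f YZ by (simp add: A.C.comp_assoc \<tau>)
    finally show "(\<tau> (ob L Z) \<cdot>\<^bsub>C\<^esub> ar T (\<delta> Z)) \<cdot>\<^bsub>C\<^esub> ar ((T \<circ>\<^sub>F A) \<circ>\<^sub>F G) f =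
        ar (G \<circ>\<^sub>F L) f \<cdot>\<^bsub>C\<^esub> \<tau> (ob L Y) \<cdot>\<^bsub>C\<^esub> ar T (\<delta> Y)"
      by simp
  qed

  have "(\<exists>!h. coalgebra_to_algebra C (T \<circ>\<^sub>F A) X c (ob T \<Psi>) ?lkl h) \<and>
      (\<exists>!h. coalgebra_to_algebra C (T \<circ>\<^sub>F A) X c (ob G \<Phi>) ?llog h) \<and>
      ?kb \<cdot>\<^bsub>C\<^esub> kl_map C A T \<mu> lam \<Psi> \<beta> X c = log_map C D G A T L \<Phi> \<alpha> \<delta> \<tau> X c"
    if X: "coalgebra C (T \<circ>\<^sub>F A) X c" for X c
  proof (intro conjI)
    show kl: "\<exists>!h. coalgebra_to_algebra C (T \<circ>\<^sub>F A) X c (ob T \<Psi>) ?lkl h"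
      using initial_algebra_inverse[OF assms(6,7)] \<Psi>(1) \<beta>_hom assms(10) X
      by (rule K.ex1_coalgebra_to_algebra_kleisli)
    show log: "\<exists>!h. coalgebra_to_algebra C (T \<circ>\<^sub>F A) X c (ob G \<Phi>) ?llog h"
      using ex1_coalgebra_to_algebra_adjoint[OF assms(11,5) TA \<rho> assms(12) X]
      by (simp add: ell_log_def)
    have "coalgebra_to_algebra C (T \<circ>\<^sub>F A) X c (ob T \<Psi>) ?lkl (kl_map C A T \<mu> lam \<Psi> \<beta> X c)"
      unfolding kl_map_def by (rule theI'[OF kl])
    moreover have "?llog \<in> Hom C (ob (T \<circ>\<^sub>F A) (ob G \<Phi>)) (ob G \<Phi>)"
      using typing by (simp add: ell_log_def Hom_iff)
    \<comment> \<open>The square says exactly that \<open>k_bar\<close> is a morphism of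
      \<open>TA\<close>-algebras, so it can be composed with \<open>kl_map\<close>.\<close>
    moreover have "algebra_morphism C (T \<circ>\<^sub>F A) (ob T \<Psi>) ?lkl (ob G \<Phi>) ?llog ?kb"
      using square typing by (simp add: algebra_morphism_def k_bar_def Hom_iff)
    ultimately have "coalgebra_to_algebra C (T \<circ>\<^sub>F A) X c (ob G \<Phi>) ?llog
        (?kb \<cdot>\<^bsub>C\<^esub> kl_map C A T \<mu> lam \<Psi> \<beta> X c)"
      using coalgebra_to_algebra_comp[OF TA X] K.ell_kl_Hom[OF \<Psi>(1) \<beta>_hom] by simp
    \<comment> \<open>Both sides solve the fixed-point equation for \<open>ell_log\<close>, whose
      solution is unique by \<open>log\<close>.\<close>
    then show "?kb \<cdot>\<^bsub>C\<^esub> kl_map C A T \<mu> lam \<Psi> \<beta> X c = log_map C D G A T L \<Phi> \<alpha> \<delta> \<tau> X c"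
      unfolding log_map_def by (rule the1_equality[OF log, symmetric])
  qed
  then show ?thesis
    using ex1_k square by blast
qed

end
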